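(* Let $G=(V,E)$ be a directed acyclic graph with $n$ vertices and $m$ edges, and let $\Gamma_1$ be a path-based hierarchical drawing of $G$. The compaction algorithm, which visits the vertices in increasing order of their $y$-coordinates in $\Gamma_1$ and assigns to each vertex $v$ the new coordinate $y(v)=0$ if $v$ has no incoming edges and $y(v)=1+\max\{y(w):(w,v)\in E\}$ otherwise (keeping $x$-coordinates unchanged), runs in $O(n+m)$ time and produces a path-based hierarchical drawing $\Gamma_2$ of $G$ whose height equals $L$, the length (number of edges) of a longest directed path in $G$.
   Context: A path-based hierarchical drawing of a DAG $G$ is obtained from a path decomposition $\{P_1,\dots,P_k\}$ of $G$ (vertex-disjoint directed paths covering all vertices): the vertices of each path $P_i$ are drawn vertically aligned on an $x$-coordinate determined by the order of $P_i$, and each vertex receives as $y$-coordinate its position in a topological sorting of $G$ (so the height of $\Gamma_1$ is $n-1$). Every edge goes from a vertex with lower $y$-coordinate to one with higher $y$-coordinate. The height of a drawing is the difference between the largest and smallest $y$-coordinates of its vertices. *)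

theory Defs
  imports "Graph_Theory.Graph_Theory" "HOL-Library.Monad_Syntax"
begin

section \<open>Directed acyclic graphs\<close>

text \<open>As usual, a graph has at least one vertex: otherwise neither the height of a drawing nor
  the length of a longest path is defined.\<close>

locale dag = pair_fin_digraph +
  assumes nonempty: "pverts G \<noteq> {}"
    and no_cycles: "acyclic (parcs G)"

text \<open>Paths are vertex sequences (\<^const>\<open>vpath\<close>); \<^const>\<open>vwalk_length\<close> counts edges, so
  a single vertex is a path of length 0.\<close>

definition longest_path_length :: "'a pair_pre_digraph \<Rightarrow> nat" where
  "longest_path_length G = Max {vwalk_length p | p. vpath p (with_proj G)}"

text \<open>Distinctness of the concatenation says that the paths are pairwise vertex-disjoint. The list
  order is the order of the paths.\<close>

definition path_decomposition :: "'a pair_pre_digraph \<Rightarrow> 'a list list \<Rightarrow> bool" where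
  "path_decomposition G Ps \<longleftrightarrow>
     (\<forall>P\<in>set Ps. vpath P (with_proj G)) \<and> distinct (concat Ps) \<and> set (concat Ps) = pverts G"

definition topological_sorting :: "'a pair_pre_digraph \<Rightarrow> 'a list \<Rightarrow> bool" where
  "topological_sorting G ts \<longleftrightarrow>
     distinct ts \<and> set ts = pverts G \<and>
     (\<forall>i<length ts. \<forall>j<length ts. (ts ! i, ts ! j) \<in> parcs G \<longrightarrow> i < j)"


section \<open>Path-based hierarchical drawings\<close>

record 'a drawing =
  xcoord :: "'a \<Rightarrow> real"
  ycoord :: "'a \<Rightarrow> nat"

text \<open>Each path has a column of its own, the columns are ordered from left to right like the paths,
  and every edge points upwards. The \<open>y\<close>-coordinates need not be positions of a topological
  sorting, since several vertices of a compacted drawing may share a \<open>y\<close>-coordinate.\<close>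

definition path_based_hierarchical_drawing ::
    "'a pair_pre_digraph \<Rightarrow> 'a list list \<Rightarrow> 'a drawing \<Rightarrow> bool" where
  "path_based_hierarchical_drawing G Ps \<Gamma> \<longleftrightarrow>
     path_decomposition G Ps \<and>
     (\<exists>column. strict_mono_on {..<length Ps} column \<and>
        (\<forall>i<length Ps. \<forall>v\<in>set (Ps ! i). xcoord \<Gamma> v = column i)) \<and>
     (\<forall>(u, v)\<in>parcs G. ycoord \<Gamma> u < ycoord \<Gamma> v)"

text \<open>The drawing before compaction: the \<open>y\<close>-coordinate of a vertex is its position, counted
  from 0, in a topological sorting, so that the height is \<open>n - 1\<close>.\<close>

definition sorted_path_based_drawing ::
    "'a pair_pre_digraph \<Rightarrow> 'a list list \<Rightarrow> 'a drawing \<Rightarrow> bool" where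
  "sorted_path_based_drawing G Ps \<Gamma> \<longleftrightarrow>
     path_based_hierarchical_drawing G Ps \<Gamma> \<and>
     (\<exists>ts. topological_sorting G ts \<and> (\<forall>i<length ts. ycoord \<Gamma> (ts ! i) = i))"

definition height :: "'a pair_pre_digraph \<Rightarrow> 'a drawing \<Rightarrow> nat" where
  "height G \<Gamma> = Max (ycoord \<Gamma> ` pverts G) - Min (ycoord \<Gamma> ` pverts G)"


section \<open>Computations with unit-cost steps\<close>

text \<open>A computation maps a memory to a result, a new memory and the number of steps taken. Reading
  or writing one cell of an array, one arithmetic operation or comparison, and one round of a loop
  (including the test that ends it) each cost one step, as on a unit-cost random-access machine.
  All numbers occurring below are at most \<open>n\<close>.\<close>

type_synonym ('s, 'r) comp = "'s \<Rightarrow> 'r \<times> 's \<times> nat"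

definition ret :: "'r \<Rightarrow> ('s, 'r) comp" where
  "ret r = (\<lambda>s. (r, s, 0))"

definition bind_comp :: "('s, 'q) comp \<Rightarrow> ('q \<Rightarrow> ('s, 'r) comp) \<Rightarrow> ('s, 'r) comp" where
  "bind_comp c f = (\<lambda>s. case c s of (q, s', t) \<Rightarrow> case f q s' of (r, s'', t') \<Rightarrow> (r, s'', t + t'))"

adhoc_overloading Monad_Syntax.bind \<rightleftharpoons> bind_comp

definition step :: "'r \<Rightarrow> ('s, 'r) comp" where
  "step r = (\<lambda>s. (r, s, 1))"

text \<open>\<open>loop xs a body\<close> runs \<open>body\<close> on the elements of \<open>xs\<close> in order; \<open>a\<close> is the
  initial content of a register that the rounds pass on.\<close>

primrec loop :: "'x list \<Rightarrow> 'r \<Rightarrow> ('x \<Rightarrow> 'r \<Rightarrow> ('s, 'r) comp) \<Rightarrow> ('s, 'r) comp" where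
  "loop [] a body = step a"
| "loop (x # xs) a body = do { _ \<leftarrow> step (); b \<leftarrow> body x a; loop xs b body }"


section \<open>The compaction algorithm\<close>

text \<open>The working memory: \<open>slot\<close> is indexed by the \<open>y\<close>-coordinates of the given drawing, the
  other two arrays by vertices. The lists in \<open>preds\<close> are linked lists: a cell holds
  a pointer to the first node, so it is read, and a node is put in front, in one step.\<close>

record 'a memory =
  slot :: "nat \<Rightarrow> 'a"
  preds :: "'a \<Rightarrow> 'a list"
  newy :: "'a \<Rightarrow> nat"

definition read_y :: "'a drawing \<Rightarrow> 'a \<Rightarrow> ('a memory, nat) comp" where
  "read_y \<Gamma> v = (\<lambda>s. (ycoord \<Gamma> v, s, 1))"

definition read_slot :: "nat \<Rightarrow> ('a memory, 'a) comp" where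
  "read_slot i = (\<lambda>s. (slot s i, s, 1))"

definition write_slot :: "nat \<Rightarrow> 'a \<Rightarrow> ('a memory, unit) comp" where
  "write_slot i v = (\<lambda>s. ((), s\<lparr>slot := (slot s)(i := v)\<rparr>, 1))"

definition read_preds :: "'a \<Rightarrow> ('a memory, 'a list) comp" where
  "read_preds v = (\<lambda>s. (preds s v, s, 1))"

definition clear_preds :: "'a \<Rightarrow> ('a memory, unit) comp" where
  "clear_preds v = (\<lambda>s. ((), s\<lparr>preds := (preds s)(v := [])\<rparr>, 1))"

definition push_pred :: "'a \<Rightarrow> 'a \<Rightarrow> ('a memory, unit) comp" where
  "push_pred v w = (\<lambda>s. ((), s\<lparr>preds := (preds s)(v := w # preds s v)\<rparr>, 1))"

definition read_newy :: "'a \<Rightarrow> ('a memory, nat) comp" where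
  "read_newy v = (\<lambda>s. (newy s v, s, 1))"

definition write_newy :: "'a \<Rightarrow> nat \<Rightarrow> ('a memory, unit) comp" where
  "write_newy v k = (\<lambda>s. ((), s\<lparr>newy := (newy s)(v := k)\<rparr>, 1))"

definition compact_vertex :: "'a \<Rightarrow> ('a memory, unit) comp" where
  "compact_vertex v = do {
     ws \<leftarrow> read_preds v;
     _ \<leftarrow> step ();
     (case ws of
        [] \<Rightarrow> write_newy v 0
      | w # ws' \<Rightarrow> do {
          k \<leftarrow> read_newy w;
          m \<leftarrow> loop ws' k (\<lambda>w' m. do { k' \<leftarrow> read_newy w'; step (max m k') });
          y \<leftarrow> step (1 + m);
          write_newy v y })
   }"

text \<open>The graph is given by its list of vertices \<open>vs\<close> and its list of edges \<open>es\<close>, both in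
  arbitrary order. The first loop counts the vertices and sorts them by \<open>y\<close>-coordinate, using that
  these coordinates are the numbers \<open>0, \<dots>, n - 1\<close>; the next two loops collect the incoming
  edges of every vertex; the last loop visits the vertices in increasing order of their given
  \<open>y\<close>-coordinates.\<close>

definition compaction :: "'a list \<Rightarrow> ('a \<times> 'a) list \<Rightarrow> 'a drawing \<Rightarrow> ('a memory, unit) comp" where
  "compaction vs es \<Gamma> = do {
     n \<leftarrow> loop vs 0 (\<lambda>v n. do { i \<leftarrow> read_y \<Gamma> v; _ \<leftarrow> write_slot i v; step (n + 1) });
     _ \<leftarrow> loop vs () (\<lambda>v _. clear_preds v);
     _ \<leftarrow> loop es () (\<lambda>(w, v) _. push_pred v w);
     loop [0..<n] () (\<lambda>i _. do { v \<leftarrow> read_slot i; compact_vertex v })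
   }"

definition graph_lists :: "'a pair_pre_digraph \<Rightarrow> 'a list \<Rightarrow> ('a \<times> 'a) list \<Rightarrow> bool" where
  "graph_lists G vs es \<longleftrightarrow>
     distinct vs \<and> set vs = pverts G \<and> distinct es \<and> set es = parcs G"

text \<open>Running time and result depend on the initial content \<open>s\<close> of the working memory, which is arbitrary.\<close>

definition compaction_time ::
    "'a list \<Rightarrow> ('a \<times> 'a) list \<Rightarrow> 'a drawing \<Rightarrow> 'a memory \<Rightarrow> nat" where
  "compaction_time vs es \<Gamma> s = (case compaction vs es \<Gamma> s of (_, _, t) \<Rightarrow> t)"

definition compacted_drawing ::
    "'a list \<Rightarrow> ('a \<times> 'a) list \<Rightarrow> 'a drawing \<Rightarrow> 'a memory \<Rightarrow> 'a drawing" where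
  "compacted_drawing vs es \<Gamma> s =
     (case compaction vs es \<Gamma> s of (_, s', _) \<Rightarrow> \<Gamma>\<lparr>ycoord := newy s'\<rparr>)"

end

theory Submission
  imports Defs
begin

text \<open>When the algorithm visits a vertex, all its predecessors precede it in the topological sorting
  and already have their final coordinates, so the computed coordinates satisfy the recurrence. The
  visit of \<open>v\<close> takes \<open>O(1 + indeg v)\<close> steps, and the in-degrees add up to \<open>m\<close>. The new
  coordinates strictly increase along every path, so no path is longer than the coordinate of its last
  vertex; conversely, walking back from \<open>v\<close> along predecessors that attain the maximum gives a
  path with exactly \<open>y(v)\<close> edges.\<close>

section \<open>Reasoning about computations\<close>

text \<open>A Hoare triple with a step count. \<open>t\<close> is only an upper bound, and
  \<open>Q\<close> sees the result as well as the memory, so that \<open>Q q\<close> can serve as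
  the precondition of the continuation.\<close>

definition runs :: "('s \<Rightarrow> bool) \<Rightarrow> ('s, 'r) comp \<Rightarrow> nat \<Rightarrow> ('r \<Rightarrow> 's \<Rightarrow> bool) \<Rightarrow> bool" where
  "runs P c t Q \<longleftrightarrow> (\<forall>s. P s \<longrightarrow> (case c s of (r, s', k) \<Rightarrow> Q r s' \<and> k \<le> t))"

lemma runs_bind:
  assumes "runs P c t Q" and "\<And>q. runs (Q q) (f q) u R"
  shows "runs P (bind_comp c f) (t + u) R"
  unfolding runs_def
proof (intro allI impI)
  fix s
  assume "P s"
  obtain q s' k where c: "c s = (q, s', k)"
    by (metis prod_cases3)
  obtain r s'' k' where f: "f q s' = (r, s'', k')"
    by (metis prod_cases3)
  have "Q q s'" "k \<le> t"
    using assms(1) \<open>P s\<close> c by (auto simp: runs_def)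
  moreover have "R r s''" "k' \<le> u"
    using assms(2)[of q] \<open>Q q s'\<close> f by (auto simp: runs_def)
  ultimately show "case bind_comp c f s of (r, s', k) \<Rightarrow> R r s' \<and> k \<le> t + u"
    by (simp add: bind_comp_def c f)
qed

lemma runs_weaken:
  assumes "runs P c t Q" and "\<And>s. P' s \<Longrightarrow> P s" and "\<And>r s. Q r s \<Longrightarrow> Q' r s" and "t \<le> t'"
  shows "runs P' c t' Q'"
  unfolding runs_def
proof (intro allI impI)
  fix s
  assume "P' s"
  obtain r s' k where c: "c s = (r, s', k)"
    by (metis prod_cases3)
  have "Q r s'" "k \<le> t"
    using assms(1) assms(2)[OF \<open>P' s\<close>] c by (auto simp: runs_def)
  then show "case c s of (r, s', k) \<Rightarrow> Q' r s' \<and> k \<le> t'"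
    using assms(3,4) by (simp add: c)
qed

lemma runs_step: "runs (P r) (step r) 1 P"
  by (simp add: runs_def step_def)

text \<open>The invariant is indexed by the processed prefix and the register. The premise speaks
  only of splits of the whole list \<open>xs\<close>, so a round may use global facts such as its
  distinctness. Each round costs one extra step, and so does the test that ends the loop.\<close>

lemma runs_loop_append:
  assumes "\<And>ys x zs a. xs = ys @ x # zs \<Longrightarrow> runs (I ys a) (body x a) (T x) (I (ys @ [x]))"
  shows "xs = us @ ws \<Longrightarrow> runs (I us a) (loop ws a body) ((\<Sum>x\<leftarrow>ws. T x + 1) + 1) (I xs)"
proof (induction ws arbitrary: us a)
  case Nil
  then show ?case
    using runs_step[of "I us" a] Nil by simp
next
  case (Cons x ws)
  have xs: "xs = us @ x # ws" "xs = (us @ [x]) @ ws"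
    using Cons.prems by simp_all
  have "runs (I us a) (bind_comp (step ()) (\<lambda>_. bind_comp (body x a) (\<lambda>b. loop ws b body)))
     (1 + (T x + ((\<Sum>x\<leftarrow>ws. T x + 1) + 1))) (I xs)"
    by (rule runs_bind[OF runs_step[of "\<lambda>_. I us a"]], rule runs_bind[OF assms[OF xs(1)]],
        rule Cons.IH[OF xs(2)])
  then show ?case
    by (simp only: loop.simps list.map sum_list.Cons add_ac)
qed

lemma runs_loop:
  assumes "\<And>ys x zs a. xs = ys @ x # zs \<Longrightarrow> runs (I ys a) (body x a) (T x) (I (ys @ [x]))"
  shows "runs (I [] a) (loop xs a body) ((\<Sum>x\<leftarrow>xs. T x + 1) + 1) (I xs)"
proof (rule runs_loop_append)
  show "xs = [] @ xs"
    by simp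
qed (fact assms)


section \<open>Layerings\<close>

text \<open>Restricting the recurrence to a set \<open>A\<close> turns it into a loop invariant,
  with \<open>A\<close> the set of vertices visited so far.\<close>

definition layering_on :: "'a rel \<Rightarrow> 'a set \<Rightarrow> ('a \<Rightarrow> nat) \<Rightarrow> bool" where
  "layering_on E A f \<longleftrightarrow>
     (\<forall>v\<in>A. f v = (if E\<inverse> `` {v} = {} then 0 else 1 + Max (f ` (E\<inverse> `` {v}))))"

text \<open>As \<open>A\<close> is closed under predecessors and \<open>x\<close> lies outside it,
  \<open>x\<close> precedes neither itself nor a vertex of \<open>A\<close>. Changing
  \<open>f\<close> at \<open>x\<close> therefore affects no right-hand side of the recurrence on
  \<open>insert x A\<close>.\<close>

lemma layering_on_insert:
  assumes "layering_on E A f" and closed: "\<And>u v. (u, v) \<in> E \<Longrightarrow> v \<in> A \<Longrightarrow> u \<in> A"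
    and "E\<inverse> `` {x} \<subseteq> A" and "x \<notin> A"
  shows "layering_on E (insert x A)
    (f(x := if E\<inverse> `` {x} = {} then 0 else 1 + Max (f ` (E\<inverse> `` {x}))))"
    (is "layering_on _ _ ?g")
proof -
  define g where "g = ?g"
  have "g ` (E\<inverse> `` {v}) = f ` (E\<inverse> `` {v})" if "v \<in> insert x A" for v
    using that assms(2-4) by (intro image_cong) (auto simp: g_def)
  moreover have "g v = f v" if "v \<in> A" for v
    using that assms(4) by (auto simp: g_def)
  moreover have "g x = (if E\<inverse> `` {x} = {} then 0 else 1 + Max (f ` (E\<inverse> `` {x})))"
    by (simp add: g_def)
  ultimately have "layering_on E (insert x A) g"
    using assms(1) by (simp add: layering_on_def)
  then show ?thesis
    by (simp add: g_def)
qed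

lemma layering_on_less:
  assumes "layering_on E A f" "finite E" "(u, v) \<in> E" "v \<in> A"
  shows "f u < f v"
proof -
  have "E\<inverse> `` {v} \<subseteq> fst ` E"
    by force
  then have "finite (E\<inverse> `` {v})"
    using assms(2) by (meson finite_imageI finite_subset)
  then have "f u \<le> Max (f ` (E\<inverse> `` {v}))"
    using assms(3) by (intro Max_ge) auto
  moreover have "f v = 1 + Max (f ` (E\<inverse> `` {v}))"
    using assms unfolding layering_on_def by auto
  ultimately show ?thesis
    by simp
qed

text \<open>A maximum over a finite nonempty set is attained; this is one step of the walk
  back.\<close>

lemma layering_on_pred:
  assumes "layering_on E A f" "finite E" "v \<in> A" "f v \<noteq> 0"
  obtains u where "(u, v) \<in> E" "f v = Suc (f u)"
proof -
  have "E\<inverse> `` {v} \<subseteq> fst ` E"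
    by force
  then have fin: "finite (E\<inverse> `` {v})"
    using assms(2) by (meson finite_imageI finite_subset)
  have ne: "E\<inverse> `` {v} \<noteq> {}" and eq: "f v = 1 + Max (f ` (E\<inverse> `` {v}))"
    using assms unfolding layering_on_def by (metis, metis)
  have "Max (f ` (E\<inverse> `` {v})) \<in> f ` (E\<inverse> `` {v})"
    using fin ne by (intro Max_in) auto
  then show thesis
    using eq that by auto
qed

lemma vwalk_snocI:
  assumes "vwalk p G" "v \<in> verts G" "(last p, v) \<in> arcs_ends G"
  shows "vwalk (p @ [v]) G"
  using assms by (auto simp: vwalk_def vwalk_arcs_append)

text \<open>Comparing all pairs rather than neighbours yields both distinctness of the walk and
  strict sortedness of \<open>map f p\<close>.\<close>

lemma vwalk_sorted_wrt:
  fixes f :: "'a \<Rightarrow> 'b :: order"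
  assumes "vwalk p G" and "\<And>u v. (u, v) \<in> arcs_ends G \<Longrightarrow> f u < f v"
  shows "sorted_wrt (\<lambda>u v. f u < f v) p"
  using assms(1)
proof (induction p rule: vwalk_induct)
  case (Cons u v es)
  then show ?case
    using assms(2)[of u v] by (auto intro: less_trans)
qed simp

lemma sorted_wrt_less_distinct:
  fixes f :: "'a \<Rightarrow> 'b :: order"
  shows "sorted_wrt (\<lambda>u v. f u < f v) p \<Longrightarrow> distinct p"
  by (induction p) auto

section \<open>Layers and longest paths in a DAG\<close>

context dag
begin

context
  fixes f :: "'a \<Rightarrow> nat"
  assumes layering: "layering_on (parcs G) (pverts G) f"
begin

lemma layering_less: "(u, v) \<in> parcs G \<Longrightarrow> f u < f v"
  using layering_on_less[OF layering] pair_finite_arcs in_arcsD2 by blast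

lemma layering_sorted: "vwalk p (with_proj G) \<Longrightarrow> sorted_wrt (\<lambda>u v. f u < f v) p"
  using layering_less by (auto intro: vwalk_sorted_wrt)

lemma vwalk_length_le_layer:
  assumes "vwalk p (with_proj G)"
  shows "vwalk_length p \<le> f (last p)"
proof -
  have "sorted_wrt (<) (map f p)"
    using layering_sorted[OF assms] by (simp add: sorted_wrt_map)
  moreover have "p \<noteq> []"
    using assms by (auto simp: vwalk_def)
  \<comment> \<open>In a strictly increasing list of natural numbers the entry at position
    \<open>i\<close> is at least \<open>i\<close>, and the last position of \<open>p\<close> is its
    number of edges.\<close>
  ultimately show ?thesis
    using sorted_wrt_less_idx[of "map f p" "length p - 1"] by (simp add: last_conv_nth)
qed

lemma vpath_of_layer_length:
  "v \<in> pverts G \<Longrightarrow> \<exists>p. vpath p (with_proj G) \<and> last p = v \<and> vwalk_length p = f v"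
proof (induction "f v" arbitrary: v)
  case 0
  then show ?case
    by (intro exI[of _ "[v]"]) (auto simp: vpath_def vwalk_def)
next
  case (Suc k)
  have "f v \<noteq> 0"
    using Suc.hyps(2) by simp
  then obtain u where u: "(u, v) \<in> parcs G" "f v = Suc (f u)"
    using layering_on_pred[OF layering pair_finite_arcs Suc.prems] by blast
  moreover from u have "u \<in> pverts G" "k = f u"
    using Suc.hyps(2) in_arcsD1 by auto
  ultimately obtain p where p: "vpath p (with_proj G)" "last p = u" "vwalk_length p = f u"
    using Suc.hyps(1) by blast
  then have walk: "vwalk (p @ [v]) (with_proj G)"
    using u Suc.prems by (intro vwalk_snocI) (auto simp: vpath_def)
  \<comment> \<open>Layers strictly increase along the extended walk, so no vertex repeats.\<close>
  moreover have "distinct (p @ [v])"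
    using sorted_wrt_less_distinct[OF layering_sorted[OF walk]] .
  \<comment> \<open>Nonemptiness of \<open>p\<close> matters: appending \<open>v\<close> to the
    empty list would add no edge.\<close>
  moreover have "vwalk_length (p @ [v]) = f v"
    using p u(2) by (cases p) (auto simp: vpath_def vwalk_def)
  ultimately show ?case
    by (intro exI[of _ "p @ [v]"] conjI vpathI) simp_all
qed

lemma longest_path_length_eq_Max_layer: "longest_path_length G = Max (f ` pverts G)"
  unfolding longest_path_length_def
proof (rule Max_eqI)
  let ?S = "{vwalk_length p | p. vpath p (with_proj G)}"
  have fin: "finite (f ` pverts G)"
    by (simp add: pair_finite_verts)
  show bound: "k \<le> Max (f ` pverts G)" if k: "k \<in> ?S" for k
  proof -
    from k obtain p where p: "k = vwalk_length p" "vwalk p (with_proj G)"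
      by (auto simp: vpath_def)
    then have "last p \<in> pverts G"
      by (auto simp: vwalk_def)
    then have "f (last p) \<le> Max (f ` pverts G)"
      using fin by simp
    then show ?thesis
      using vwalk_length_le_layer[OF p(2)] unfolding p(1) by (rule order_trans[rotated])
  qed
  \<comment> \<open>The bound on path lengths is also what makes their set finite, so that its
    \<open>Max\<close> is meaningful.\<close>
  show "finite ?S"
    using bound by (intro finite_subset[OF _ finite_atMost]) (blast intro: atMost_iff[THEN iffD2])
  have "Max (f ` pverts G) \<in> f ` pverts G"
    using fin nonempty by (intro Max_in) auto
  then obtain v where "v \<in> pverts G" "Max (f ` pverts G) = f v"
    by auto
  then show "Max (f ` pverts G) \<in> ?S"
    using vpath_of_layer_length[of v] by (metis (mono_tags, lifting) mem_Collect_eq)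
qed

text \<open>A vertex of least layer, if that layer were positive, would have a predecessor one layer
  below. Hence the height is simply the largest layer.\<close>

lemma Min_layer: "Min (f ` pverts G) = 0"
proof (rule ccontr)
  assume ne: "Min (f ` pverts G) \<noteq> 0"
  have fin: "finite (f ` pverts G)"
    by (simp add: pair_finite_verts)
  have "Min (f ` pverts G) \<in> f ` pverts G"
    using fin nonempty by (intro Min_in) auto
  then obtain v where v: "v \<in> pverts G" "Min (f ` pverts G) = f v"
    by auto
  then obtain u where u: "(u, v) \<in> parcs G" "f v = Suc (f u)"
    using layering_on_pred[OF layering pair_finite_arcs] ne by metis
  then have "f v \<le> f u"
    using Min_le[OF fin, of "f u"] v(2) in_arcsD1 by auto
  then show False
    using u(2) by simp
qed

end

end


section \<open>The algorithm\<close>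

text \<open>The precondition \<open>(=) s\<close> fixes the initial memory, so that the
  postcondition can describe the final one exactly.\<close>

lemma runs_compact_vertex:
  "runs ((=) s) (compact_vertex v) (5 + 3 * length (preds s v))
     (\<lambda>_ s'. s' = s\<lparr>newy := (newy s)(v := if preds s v = [] then 0
        else 1 + Max (newy s ` set (preds s v)))\<rparr>)"
proof (cases "preds s v")
  case Nil
  then show ?thesis
    by (simp add: runs_def compact_vertex_def bind_comp_def read_preds_def step_def write_newy_def)
next
  case (Cons w ws)
  let ?c = "loop ws (newy s w) (\<lambda>w' m. bind_comp (read_newy w') (\<lambda>k'. step (max m k')))"
  \<comment> \<open>The head \<open>w\<close> initialises the register, so every maximum is over a
    nonempty set.\<close>
  let ?I = "\<lambda>ys m s'. s' = s \<and> m = Max (newy s ` set (w # ys))"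
  have "runs (?I [] (newy s w)) ?c ((\<Sum>x\<leftarrow>ws. 2 + 1) + 1) (?I ws)"
  proof (rule runs_loop)
    fix ys x zs a
    have "Max (newy s ` set (w # ys @ [x])) = max (Max (newy s ` set (w # ys))) (newy s x)"
      by (simp add: insert_commute max.commute flip: Max_insert)
    then show "runs (?I ys a) (bind_comp (read_newy x) (\<lambda>k'. step (max a k'))) 2 (?I (ys @ [x]))"
      by (simp add: runs_def bind_comp_def read_newy_def step_def)
  qed
  then obtain t where t: "?c s = (Max (newy s ` set (w # ws)), s, t)" "t \<le> 3 * length ws + 1"
    by (auto simp: runs_def sum_list_triv split: prod.splits)
  show ?thesis
    using t Cons unfolding runs_def compact_vertex_def
    by (simp add: bind_comp_def read_preds_def read_newy_def step_def write_newy_def)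
qed

section \<open>Prefixes of a topological sorting, and in-degrees\<close>

lemma set_take_Suc: "i < length xs \<Longrightarrow> set (take (Suc i) xs) = insert (xs ! i) (set (take i xs))"
  by (simp add: take_Suc_conv_app_nth)

lemma topological_sorting_pred_in_take:
  assumes "topological_sorting G ts" "(u, ts ! i) \<in> parcs G" "u \<in> pverts G" "i < length ts"
  shows "u \<in> set (take i ts)"
proof -
  obtain j where "j < length ts" "u = ts ! j"
    using assms by (metis in_set_conv_nth topological_sorting_def)
  moreover from this have "j < i"
    using assms by (auto simp: topological_sorting_def)
  ultimately show ?thesis
    using assms(4) by (force simp: in_set_conv_nth)
qed

text \<open>The edges are grouped by their heads; \<open>u \<mapsto> (u, v)\<close> matches the
  predecessors of \<open>v\<close> with the edges into \<open>v\<close>.\<close>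

lemma sum_list_indegree:
  assumes "distinct xs" and "set xs = V" and "finite E" and "snd ` E \<subseteq> V"
  shows "(\<Sum>v\<leftarrow>xs. card (E\<inverse> `` {v})) = card E"
proof -
  have eq: "card (E\<inverse> `` {v}) = card {e \<in> E. snd e = v}" for v
    by (rule bij_betw_same_card[of "\<lambda>u. (u, v)"]) (force simp: bij_betw_def inj_on_def)
  have "(\<Sum>v\<leftarrow>xs. card (E\<inverse> `` {v})) = (\<Sum>v\<in>V. \<Sum>e\<in>{e \<in> E. snd e = v}. 1)"
    using assms by (simp add: eq sum_list_distinct_conv_sum_set)
  also have "\<dots> = card E"
    using assms by (subst sum.group) auto
  finally show ?thesis .
qed

text \<open>The four loops are verified in turn, starting from arbitrary memory; what one loop
  establishes is the precondition of the next.\<close>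

lemma runs_compaction:
  assumes "dag G" and ts: "topological_sorting G ts" "\<And>i. i < length ts \<Longrightarrow> ycoord \<Gamma> (ts ! i) = i"
    and lists: "graph_lists G vs es"
  shows "runs (\<lambda>_. True) (compaction vs es \<Gamma>) (17 * (card (pverts G) + card (parcs G)))
     (\<lambda>_ s. layering_on (parcs G) (pverts G) (newy s))"
proof -
  interpret dag G
    by fact
  let ?V = "pverts G" and ?E = "parcs G"
  have vs: "distinct vs" "set vs = ?V" "distinct es" "set es = ?E"
    using lists by (auto simp: graph_lists_def)
  have ts': "distinct ts" "set ts = ?V"
    using ts by (auto simp: topological_sorting_def)
  have lengths: "length ts = card ?V" "length vs = card ?V" "length es = card ?E"
    using vs ts' by (metis distinct_card)+
  \<comment> \<open>Distinct vertices use distinct slots, so the first loop never overwrites an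
    entry.\<close>
  have inj: "u = v" if "u \<in> ?V" "v \<in> ?V" "ycoord \<Gamma> u = ycoord \<Gamma> v" for u v
    using that ts(2) ts'(2) by (metis in_set_conv_nth)

  define sorted :: "'a memory \<Rightarrow> bool" where "sorted s \<longleftrightarrow> (\<forall>i<length ts. slot s i = ts ! i)" for s
  \<comment> \<open>Distinctness of the lists is recorded for the running time: it makes their
    lengths equal to the in-degrees.\<close>
  define adj :: "'a memory \<Rightarrow> bool" where
    "adj s \<longleftrightarrow> (\<forall>v\<in>?V. distinct (preds s v) \<and> set (preds s v) = ?E\<inverse> `` {v})" for s

  have "runs (\<lambda>_. True)
      (loop vs 0 (\<lambda>v n. bind_comp (read_y \<Gamma> v) (\<lambda>i. bind_comp (write_slot i v) (\<lambda>_. step (n + 1)))))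
      ((\<Sum>x\<leftarrow>vs. 3 + 1) + 1)
      (\<lambda>n s. n = length vs \<and> (\<forall>v\<in>set vs. slot s (ycoord \<Gamma> v) = v))"
  proof (rule runs_weaken[OF runs_loop[where
        I = "\<lambda>ys n s. n = length ys \<and> (\<forall>v\<in>set ys. slot s (ycoord \<Gamma> v) = v)"]])
    fix ys x zs a
    assume "vs = ys @ x # zs"
    then have "v \<in> ?V \<and> x \<in> ?V" if "v \<in> set ys" for v
      using that vs(2) by auto
    then show "runs (\<lambda>s. a = length ys \<and> (\<forall>v\<in>set ys. slot s (ycoord \<Gamma> v) = v))
      (bind_comp (read_y \<Gamma> x) (\<lambda>i. bind_comp (write_slot i x) (\<lambda>_. step (a + 1)))) 3
      (\<lambda>b s. b = length (ys @ [x]) \<and> (\<forall>v\<in>set (ys @ [x]). slot s (ycoord \<Gamma> v) = v))"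
      by (auto simp: runs_def bind_comp_def read_y_def write_slot_def step_def dest: inj)
  qed auto
  then have loop1: "runs (\<lambda>_. True)
      (loop vs 0 (\<lambda>v n. bind_comp (read_y \<Gamma> v) (\<lambda>i. bind_comp (write_slot i v) (\<lambda>_. step (n + 1)))))
      (4 * card ?V + 1) (\<lambda>n s. n = card ?V \<and> sorted s)"
  proof (rule runs_weaken)
    fix n and s :: "'a memory"
    assume inv: "n = length vs \<and> (\<forall>v\<in>set vs. slot s (ycoord \<Gamma> v) = v)"
    have "slot s i = ts ! i" if "i < length ts" for i
    proof -
      have "ts ! i \<in> set vs"
        using that vs(2) ts'(2) nth_mem by metis
      then show ?thesis
        using inv ts(2)[OF that] by metis
    qed
    then show "n = card ?V \<and> sorted s"
      using inv lengths by (simp add: sorted_def)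
  qed (simp_all add: sum_list_triv lengths)

  have "runs sorted (loop vs () (\<lambda>v _. clear_preds v)) ((\<Sum>x\<leftarrow>vs. 1 + 1) + 1)
      (\<lambda>_ s. sorted s \<and> (\<forall>v\<in>set vs. preds s v = []))"
    by (rule runs_weaken[OF runs_loop[where
        I = "\<lambda>ys _ s. sorted s \<and> (\<forall>v\<in>set ys. preds s v = [])"]])
      (auto simp: runs_def clear_preds_def sorted_def)
  then have loop2: "runs sorted (loop vs () (\<lambda>v _. clear_preds v)) (2 * card ?V + 1)
      (\<lambda>_ s. sorted s \<and> (\<forall>v\<in>?V. preds s v = []))"
    using vs lengths by (simp add: sum_list_triv mult_2)

  have "runs (\<lambda>s. sorted s \<and> (\<forall>v\<in>?V. preds s v = [])) (loop es () (\<lambda>(w, v) _. push_pred v w))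
      ((\<Sum>x\<leftarrow>es. 1 + 1) + 1) (\<lambda>_ s. sorted s \<and> adj s)"
  proof (rule runs_weaken[OF runs_loop[where I = "\<lambda>ys _ s. sorted s \<and>
        (\<forall>v\<in>?V. distinct (preds s v) \<and> set (preds s v) = (set ys)\<inverse> `` {v})"]])
    fix ys x zs a
    assume "es = ys @ x # zs"
    then show "runs (\<lambda>s. sorted s \<and>
        (\<forall>v\<in>?V. distinct (preds s v) \<and> set (preds s v) = (set ys)\<inverse> `` {v}))
      ((\<lambda>(w, v) _. push_pred v w) x a) 1
      (\<lambda>_ s. sorted s \<and>
        (\<forall>v\<in>?V. distinct (preds s v) \<and> set (preds s v) = (set (ys @ [x]))\<inverse> `` {v}))"
      \<comment> \<open>As \<open>es\<close> has no repetitions, the edge \<open>x\<close> is not in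
        \<open>ys\<close>, and the pushed predecessor is new to its list.\<close>
      using vs(3) by (cases x) (auto simp: runs_def push_pred_def sorted_def)
  qed (auto simp: adj_def vs(4))
  then have loop3: "runs (\<lambda>s. sorted s \<and> (\<forall>v\<in>?V. preds s v = []))
      (loop es () (\<lambda>(w, v) _. push_pred v w)) (2 * card ?E + 1) (\<lambda>_ s. sorted s \<and> adj s)"
    using lengths by (simp add: sum_list_triv mult_2)

  \<comment> \<open>One step for reading the slot is added to the cost of
    \<open>compact_vertex\<close>.\<close>
  define T where "T i = 6 + 3 * card (?E\<inverse> `` {ts ! i})" for i
  \<comment> \<open>After \<open>length ys\<close> rounds the visited vertices are that many first
    entries of \<open>ts\<close>.\<close>
  define I where "I ys u s \<longleftrightarrow>
      sorted s \<and> adj s \<and> layering_on ?E (set (take (length ys) ts)) (newy s)"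
    for ys :: "nat list" and u :: unit and s
  have "runs (I [] ()) (loop [0..<length ts] () (\<lambda>i _. bind_comp (read_slot i) compact_vertex))
      ((\<Sum>i\<leftarrow>[0..<length ts]. T i + 1) + 1) (I [0..<length ts])"
  proof (rule runs_loop)
    fix ys i zs a
    assume upt: "[0..<length ts] = ys @ i # zs"
    have "length ys < length ts"
      using arg_cong[OF upt, of length] by simp
    \<comment> \<open>The entry of \<open>[0..<length ts]\<close> at any position is the position
      itself.\<close>
    then have i: "length ys = i"
      using arg_cong[OF upt, of "\<lambda>xs. xs ! length ys"] by simp
    then have "i < length ts"
      using \<open>length ys < length ts\<close> by simp
    define v where "v = ts ! i"
    have v: "v \<in> ?V"
      unfolding v_def using nth_mem[OF \<open>i < length ts\<close>] ts'(2) by metis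
    show "runs (I ys a) (bind_comp (read_slot i) compact_vertex) (T i) (I (ys @ [i]))"
      unfolding runs_def
    proof (intro allI impI)
      fix s
      assume inv: "I ys a s"
      then have s: "slot s i = v" "distinct (preds s v)" "set (preds s v) = ?E\<inverse> `` {v}"
        using v \<open>i < length ts\<close> by (auto simp: I_def sorted_def adj_def v_def)
      define s' where "s' = s\<lparr>newy := (newy s)(v := if preds s v = [] then 0
        else 1 + Max (newy s ` set (preds s v)))\<rparr>"
      obtain t where t: "compact_vertex v s = ((), s', t)" "t \<le> 5 + 3 * length (preds s v)"
        using runs_compact_vertex[of s v] by (auto simp: runs_def s'_def split: prod.splits)
      have "layering_on ?E (insert v (set (take i ts))) ((newy s)(v :=
          if ?E\<inverse> `` {v} = {} then 0 else 1 + Max (newy s ` (?E\<inverse> `` {v}))))"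
      proof (rule layering_on_insert)
        show "layering_on ?E (set (take i ts)) (newy s)"
          using inv i by (simp add: I_def)
        show "?E\<inverse> `` {v} \<subseteq> set (take i ts)"
          using topological_sorting_pred_in_take[OF ts(1)] \<open>i < length ts\<close> in_arcsD1
          by (auto simp: v_def)
        show "v \<notin> set (take i ts)"
          using ts'(1) \<open>i < length ts\<close>
          by (auto simp: v_def in_set_conv_nth nth_eq_iff_index_eq)
        \<comment> \<open>A prefix of a topological sorting is closed under predecessors.\<close>
        show "u \<in> set (take i ts)" if uw: "(u, w) \<in> ?E" "w \<in> set (take i ts)" for u w
        proof -
          obtain j where j: "j < i" "w = ts ! j" "j < length ts"
            using uw(2) by (auto simp: in_set_conv_nth)
          then have "u \<in> set (take j ts)"
            using topological_sorting_pred_in_take[OF ts(1)] uw(1) in_arcsD1 by auto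
          then show ?thesis
            using j(1) by (meson less_imp_le_nat set_take_subset_set_take subsetD)
        qed
      qed
      moreover have "newy s' = (newy s)(v :=
          if ?E\<inverse> `` {v} = {} then 0 else 1 + Max (newy s ` (?E\<inverse> `` {v})))"
        by (simp add: s'_def flip: s(3))
      moreover have "set (take (Suc i) ts) = insert v (set (take i ts))"
        unfolding v_def by (rule set_take_Suc) fact
      ultimately have "layering_on ?E (set (take (Suc i) ts)) (newy s')"
        by simp
      then have "I (ys @ [i]) () s'"
        using inv i by (simp add: I_def s'_def sorted_def adj_def)
      moreover have "t + 1 \<le> T i"
        using t(2) s distinct_card[OF s(2)] by (simp add: T_def v_def)
      ultimately show "case bind_comp (read_slot i) compact_vertex s of
          (r, s', k) \<Rightarrow> I (ys @ [i]) r s' \<and> k \<le> T i"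
        using s(1) t(1) by (simp add: bind_comp_def read_slot_def)
    qed
  qed
  moreover have "(\<Sum>i\<leftarrow>[0..<length ts]. T i + 1) = 7 * card ?V + 3 * card ?E"
  proof -
    \<comment> \<open>Summing over the entries of \<open>ts\<close> instead of its indices makes
      \<open>sum_list_indegree\<close> applicable; 7 is the 6 of \<open>T\<close> plus the step of
      the round.\<close>
    have "(\<Sum>i\<leftarrow>[0..<length ts]. T i + 1) =
        (\<Sum>v\<leftarrow>map ((!) ts) [0..<length ts]. 7 + 3 * card (?E\<inverse> `` {v}))"
      by (simp add: T_def comp_def del: map_nth)
    also have "\<dots> = 7 * card ?V + 3 * (\<Sum>v\<leftarrow>ts. card (?E\<inverse> `` {v}))"
      unfolding map_nth by (simp add: sum_list_addf sum_list_const_mult sum_list_triv lengths)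
    also have "(\<Sum>v\<leftarrow>ts. card (?E\<inverse> `` {v})) = card ?E"
      using ts' pair_finite_arcs in_arcsD2 by (intro sum_list_indegree) auto
    finally show ?thesis .
  qed
  ultimately have "runs (I [] ()) (loop [0..<card ?V] () (\<lambda>i _. bind_comp (read_slot i) compact_vertex))
      (7 * card ?V + 3 * card ?E + 1) (I [0..<card ?V])"
    by (simp only: lengths)
  \<comment> \<open>Initially the recurrence holds vacuously on the empty prefix; finally the prefix
    is all of \<open>ts\<close> and covers \<open>?V\<close>.\<close>
  then have loop4: "runs (\<lambda>s. sorted s \<and> adj s)
      (loop [0..<card ?V] () (\<lambda>i _. bind_comp (read_slot i) compact_vertex))
      (7 * card ?V + 3 * card ?E + 1) (\<lambda>_ s. layering_on ?E ?V (newy s))"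
    by (rule runs_weaken) (use ts'(2) lengths in \<open>simp_all add: I_def layering_on_def\<close>)

  \<comment> \<open>With n vertices and m edges, the four bounds add up to 13n + 5m + 4; as n is
    positive, 17(n + m) absorbs the 4.\<close>
  have "card ?V > 0"
    using nonempty pair_finite_verts by (simp add: card_gt_0_iff)
  show ?thesis
    unfolding compaction_def
  proof (rule runs_weaken[OF runs_bind[OF loop1 runs_bind[OF _ runs_bind]]])
    \<comment> \<open>The bind rule leaves the first loop's result \<open>n\<close> arbitrary. The
      equation \<open>n = card ?V\<close> is carried through the assertions to fix the range of the
      last loop.\<close>
    show "runs (\<lambda>s. n = card ?V \<and> sorted s) (loop vs () (\<lambda>v _. clear_preds v)) (2 * card ?V + 1)
      (\<lambda>_ s. n = card ?V \<and> sorted s \<and> (\<forall>v\<in>?V. preds s v = []))" for n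
      using loop2 by (auto simp: runs_def)
    show "runs (\<lambda>s. n = card ?V \<and> sorted s \<and> (\<forall>v\<in>?V. preds s v = []))
      (loop es () (\<lambda>(w, v) _. push_pred v w)) (2 * card ?E + 1)
      (\<lambda>_ s. n = card ?V \<and> sorted s \<and> adj s)" for n
      using loop3 by (auto simp: runs_def)
    show "runs (\<lambda>s. n = card ?V \<and> sorted s \<and> adj s)
      (loop [0..<n] () (\<lambda>i _. bind_comp (read_slot i) compact_vertex))
      (7 * card ?V + 3 * card ?E + 1) (\<lambda>_ s. layering_on ?E ?V (newy s))" for n
      using loop4 by (auto simp: runs_def)
  qed (use \<open>card ?V > 0\<close> in auto)
qed

section \<open>Running time, validity and height of the compacted drawing\<close>

theorem theorem3p3:
  shows "\<exists>C::nat. \<forall>(G :: 'a pair_pre_digraph) Ps \<Gamma>\<^sub>1 vs es s.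
    dag G \<longrightarrow> sorted_path_based_drawing G Ps \<Gamma>\<^sub>1 \<longrightarrow> graph_lists G vs es \<longrightarrow>
    (let \<Gamma>\<^sub>2 = compacted_drawing vs es \<Gamma>\<^sub>1 s in
       compaction_time vs es \<Gamma>\<^sub>1 s \<le> C * (card (pverts G) + card (parcs G)) \<and>
       xcoord \<Gamma>\<^sub>2 = xcoord \<Gamma>\<^sub>1 \<and>
       (\<forall>v\<in>pverts G. ycoord \<Gamma>\<^sub>2 v =
          (if \<nexists>w. (w, v) \<in> parcs G then 0
           else 1 + Max {ycoord \<Gamma>\<^sub>2 w | w. (w, v) \<in> parcs G})) \<and>
       path_based_hierarchical_drawing G Ps \<Gamma>\<^sub>2 \<and>
       height G \<Gamma>\<^sub>2 = longest_path_length G)"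
\<comment> \<open>The constant is the one from \<open>runs_compaction\<close>, which depends neither
  on the graph nor on the memory.\<close>
proof (intro exI[of _ 17] allI impI)
  fix G :: "'a pair_pre_digraph" and Ps \<Gamma>\<^sub>1 vs es and s :: "'a memory"
  assume "dag G" and drawing: "sorted_path_based_drawing G Ps \<Gamma>\<^sub>1" and "graph_lists G vs es"
  interpret dag G
    by fact
  obtain ts where "topological_sorting G ts" "\<And>i. i < length ts \<Longrightarrow> ycoord \<Gamma>\<^sub>1 (ts ! i) = i"
    using drawing by (auto simp: sorted_path_based_drawing_def)
  note correct = runs_compaction[OF \<open>dag G\<close> this \<open>graph_lists G vs es\<close>]
  obtain s' t where run: "compaction vs es \<Gamma>\<^sub>1 s = ((), s', t)"
    by (cases "compaction vs es \<Gamma>\<^sub>1 s") simp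
  have layering: "layering_on (parcs G) (pverts G) (newy s')"
    and t: "t \<le> 17 * (card (pverts G) + card (parcs G))"
    using correct[unfolded runs_def, rule_format, of s] unfolding run by simp_all
  have "newy s' v = (if \<nexists>w. (w, v) \<in> parcs G then 0
      else 1 + Max {newy s' w | w. (w, v) \<in> parcs G})" if "v \<in> pverts G" for v
  proof -
    have "newy s' ` ((parcs G)\<inverse> `` {v}) = {newy s' w | w. (w, v) \<in> parcs G}"
      by auto
    moreover have "(parcs G)\<inverse> `` {v} = {} \<longleftrightarrow> (\<nexists>w. (w, v) \<in> parcs G)"
      by auto
    ultimately show ?thesis
      using layering[unfolded layering_on_def, rule_format, OF that] by (simp only:)
  qed
  \<comment> \<open>Paths and columns are inherited; only the upward direction of the edges has to
    be checked anew.\<close>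
  moreover have "path_based_hierarchical_drawing G Ps (\<Gamma>\<^sub>1\<lparr>ycoord := newy s'\<rparr>)"
    using drawing layering_less[OF layering]
    by (auto simp: sorted_path_based_drawing_def path_based_hierarchical_drawing_def)
  moreover have "height G (\<Gamma>\<^sub>1\<lparr>ycoord := newy s'\<rparr>) = longest_path_length G"
    by (simp add: height_def Min_layer[OF layering] longest_path_length_eq_Max_layer[OF layering])
  ultimately show "let \<Gamma>\<^sub>2 = compacted_drawing vs es \<Gamma>\<^sub>1 s in
       compaction_time vs es \<Gamma>\<^sub>1 s \<le> 17 * (card (pverts G) + card (parcs G)) \<and>
       xcoord \<Gamma>\<^sub>2 = xcoord \<Gamma>\<^sub>1 \<and>
       (\<forall>v\<in>pverts G. ycoord \<Gamma>\<^sub>2 v =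
          (if \<nexists>w. (w, v) \<in> parcs G then 0
           else 1 + Max {ycoord \<Gamma>\<^sub>2 w | w. (w, v) \<in> parcs G})) \<and>
       path_based_hierarchical_drawing G Ps \<Gamma>\<^sub>2 \<and>
       height G \<Gamma>\<^sub>2 = longest_path_length G"
    using t unfolding Let_def
    by (simp add: compacted_drawing_def compaction_time_def run)
qed

end
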